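(* Let $k\ge 1$ be an integer. For every finitely supported function $u:\mathbb{Z}\to\mathbb{C}$ with $u(0)=0$, $$\sum_{n\in\mathbb{Z}}|u(n)-u(n-1)|^2\Big(n-\frac12\Big)^{2k}\;\ge\;\frac{(2k-1)^2}{4}\sum_{n\in\mathbb{Z}}|u(n)|^2 n^{2k-2}.$$ Moreover, the constant $(2k-1)^2/4$ is sharp, i.e. the inequality fails for some such $u$ if the constant is replaced by any strictly larger one.
   Context: The convention $n^0=1$ is used (irrelevant at $n=0$ since $u(0)=0$). *)

theory Defs
  imports "HOL-Analysis.Infinite_Sum"
begin

end

(* Each edge energy is split between its two endpoints.  Put j = k - 1, a_n = (n - 1/2)^(2k).  The
   cross term 2 a_n |u(n)| |u(n-1)| is bounded by R(n) |u(n)|^2 + R(1-n) |u(n-1)|^2 whenever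
   R(n) R(1-n) >= a_n^2, and it then remains to check, vertex by vertex, that the shares
   (a_n - R(n)) + (a_{-n} - R(-n)) left to n dominate (j + 1/2)^2 n^(2j).  The choice
   R(n) = C(n) (n (n-1/2)^2 / (n-1))^j corresponds to the substitution u(n) = n^(-j) v(n), which
   reduces the edge condition to the case k = 1, i.e. to C(n) C(1-n) >= (n-1/2)^4.  Here
   C(n) = n^2 - n/2 + 1/8 would suffice for k = 1; the lower order terms -1/(4n) - 1/(8n^2) gain the
   slack that the case k = 2 needs.  With x = 1/n, the vertex inequality is proved by taking
   second differences in j, since its two sides are a combination of geometric sequences in j and a
   quadratic polynomial in j.

   For sharpness, the critical profile n^(-(j + 1/2)) is cut off linearly between N and 2N.  The
   cut-off costs a bounded amount of energy, whereas both sides grow like the N-th harmonic number,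
   with ratio tending to (j + 1/2)^2. *)
theory Submission
  imports Defs "HOL-Analysis.Harmonic_Numbers"
begin

section \<open>The edge condition in the case j = 0\<close>

definition edge_factor :: "real \<Rightarrow> real"
  where "edge_factor y = y^2 - y/2 + 1/8 - 1/(4*y) - 1/(8*y^2)"

text \<open>Clearing the denominator \<open>8*y^2\<close> turns both the positivity of
  \<open>edge_factor\<close> and the product condition into polynomial questions.\<close>

definition edge_numer :: "real \<Rightarrow> real"
  where "edge_numer y = 8*y^4 - 4*y^3 + y^2 - 2*y - 1"

lemma edge_factor_eq_numer: "edge_factor y * (8*y^2) = edge_numer y" if "y \<noteq> 0"
  using that
  by (simp add: edge_factor_def edge_numer_def field_simps power2_eq_square power3_eq_cube power4_eq_xxxx)

text \<open>The points \<open>2 + t\<close> and \<open>-1 - t\<close> with \<open>t >= 0\<close>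
  cover all integers except 0 and 1 and are exchanged by \<open>y\<close> to \<open>1 - y\<close>.
  Expanded there, the polynomial has only positive coefficients.\<close>

lemma edge_numer_right: "edge_numer (2 + t) = 8*t^4 + 60*t^3 + 169*t^2 + 210*t + 95"
  unfolding edge_numer_def by algebra

lemma edge_numer_left: "edge_numer (-1 - t) = 8*t^4 + 36*t^3 + 61*t^2 + 48*t + 14"
  unfolding edge_numer_def by algebra

lemma edge_factor_pos: "edge_factor y > 0" if "y \<ge> 2 \<or> y \<le> -1"
proof -
  have y: "y \<noteq> 0" using that by auto
  have "edge_numer (2 + t) > 0" "edge_numer (-1 - t) > 0" if "t \<ge> 0" for t
    unfolding edge_numer_left edge_numer_right
    using that zero_le_power[OF that, of 3] zero_le_power[OF that, of 4] zero_le_power2[of t]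
    by linarith+
  from this(1)[of "y - 2"] this(2)[of "-1 - y"] have "edge_numer y > 0" using that by auto
  then have "0 < edge_factor y * (8*y^2)" using edge_factor_eq_numer[OF y] by simp
  then show ?thesis using y by (simp add: zero_less_mult_iff)
qed

lemma edge_factor_mult_ge: "edge_factor y * edge_factor (1 - y) \<ge> (y - 1/2)^4"
  if "y \<ge> 2 \<or> y \<le> -1"
proof -
  \<comment> \<open>The condition is invariant under \<open>y\<close> to \<open>1 - y\<close>, so
    one half-line is enough.\<close>
  have main: "edge_factor y * edge_factor (1 - y) \<ge> (y - 1/2)^4" if "y \<ge> 2" for y
  proof -
    define t where "t = y - 2"
    have t: "t \<ge> 0" "y = 2 + t" "1 - y = -1 - t" using that by (auto simp: t_def)
    have "(edge_factor y * edge_factor (1 - y) - (y - 1/2)^4) * (64 * y^2 * (1-y)^2)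
        = (edge_factor y * (8*y^2)) * (edge_factor (1 - y) * (8*(1-y)^2)) - 64 * y^2 * (1-y)^2 * (y - 1/2)^4"
      by (simp add: algebra_simps)
    also have "\<dots> = edge_numer y * edge_numer (1 - y) - 64 * y^2 * (1-y)^2 * (y - 1/2)^4"
      using that by (simp add: edge_factor_eq_numer)
    \<comment> \<open>The terms of degree 5 to 8 cancel, and the remaining coefficients are
      positive.\<close>
    also have "\<dots> = 34 + 156*t + 205*t^2 + 102*t^3 + 17*t^4"
      unfolding t(3)
        unfolding t(2) edge_numer_right edge_numer_left by (simp add: field_simps) algebra
    also have "\<dots> \<ge> 0" using t(1) by simp
    finally have "0 \<le> (edge_factor y * edge_factor (1 - y) - (y - 1/2)^4) * (64 * y^2 * (1-y)^2)" .
    moreover have "64 * y^2 * (1-y)^2 > 0" using that by simp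
    ultimately show ?thesis by (metis diff_ge_0_iff_ge linorder_not_less mult_neg_pos)
  qed
  have sw: "(1 - y - 1/2)^4 = (y - 1/2)^4" by algebra
  from that show ?thesis
    using main[of y] main[of "1 - y"] sw by (auto simp: mult.commute)
qed

section \<open>Second differences in j and the vertex inequality in x = 1/n\<close>

text \<open>The sequence \<open>(j + 1/2)^2 * c\<close> has second difference \<open>2*c\<close> and
  rises by \<open>4*c\<close> from 1 to 2. Starting the summation at that step, with the value at 0
  treated apart, allows \<open>D 1 - D 0\<close> to fall short of \<open>2*c\<close>, which happens
  in \<open>deficit_bound\<close>.\<close>

lemma second_difference_bound:
  fixes D :: "nat \<Rightarrow> real"
  assumes "D 0 \<ge> c/4" "D 1 \<ge> 9/4*c" "D (Suc (Suc 0)) - D 1 \<ge> 4*c"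
    and *: "\<And>j. D (Suc (Suc j)) - 2 * D (Suc j) + D j \<ge> 2 * c"
  shows "D j \<ge> (real j + 1/2)^2 * c"
proof -
  have d: "D (Suc (Suc j)) - D (Suc j) \<ge> (2 * real j + 4) * c" for j
  proof (induction j)
    case 0
    then show ?case using assms by simp
  next
    case (Suc j)
    then show ?case using *[of "Suc j"] by (simp add: algebra_simps)
  qed
  have "D (Suc j) \<ge> (real (Suc j) + 1/2)^2 * c" for j
  proof (induction j)
    case 0
    then show ?case using assms by (simp add: power2_eq_square)
  next
    case (Suc j)
    then show ?case using d[of j] by (simp add: algebra_simps power2_eq_square)
  qed
  then show ?thesis using assms(1) by (cases j) (auto simp: power2_eq_square)
qed

text \<open>This is the vertex inequality at y = 1/x divided by \<open>y^(2*j+2)\<close>: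
  \<open>p\<close>, \<open>q\<close> come from the weights of the two edges at y, and
  \<open>cp\<close>, \<open>cm\<close> from \<open>edge_factor\<close> at -y and y. The negative
  terms have ratios \<open>1 + a\<close> and \<open>1 + b\<close> with a, b of order x^2, so their
  second differences are only of order x^4 at j = 0.\<close>

lemma deficit_bound:
  fixes x :: real
  assumes x: "0 < x" "x \<le> 1/2"
  defines "p \<equiv> (1 + x/2)^2" and "q \<equiv> (1 - x/2)^2"
  defines "cp \<equiv> 1 + x/2 + x^2/8 + x^3/4 - x^4/8" and "cm \<equiv> 1 - x/2 + x^2/8 - x^3/4 - x^4/8"
  shows "p^(j+1) + q^(j+1) - cp * (p/(1+x))^j - cm * (q/(1-x))^j \<ge> (real j + 1/2)^2 * x^2"
proof -
  define a where "a = x^2/(4*(1+x))"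
  define b where "b = x^2/(4*(1-x))"
  have h: "p/(1+x) = 1 + a" and g: "q/(1-x) = 1 + b"
    using x unfolding p_def q_def a_def b_def by (simp_all add: field_simps power2_eq_square)
  have ab: "0 \<le> a" "a \<le> x^2/4" "0 \<le> b" "b \<le> x^2/2"
  proof -
    have "x^2/4 \<le> x^2/4 * (1+x)" using x by (simp add: algebra_simps)
    then show "0 \<le> a" "a \<le> x^2/4" using x by (simp_all add: a_def divide_simps)
    have "x^2 * (4*(1-x)) \<ge> x^2 * 2" using x by (intro mult_left_mono) auto
    then show "0 \<le> b" "b \<le> x^2/2" using x by (simp_all add: b_def divide_simps)
  qed
  have "x^2 \<le> x/2"
    using x mult_left_mono[of x "1/2" x] by (simp add: power2_eq_square)
  then have xx: "x^2 \<le> x/2" "x^2 \<le> 1/4"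
    using x by linarith+
  have x34: "x^3 \<le> 1/8" "x^4 \<le> 1/16" "0 \<le> x^3" "0 \<le> x^4"
    using x power_mono[of x "1/2" 3] power_mono[of x "1/2" 4] by (auto simp: power_divide)
  have cp: "0 \<le> cp" "cp \<le> 3/2" and cm: "0 \<le> cm" "cm \<le> 1"
    unfolding cp_def cm_def using x xx x34 zero_le_power2[of x] by linarith+
  have p: "p = 1 + x*(1+x/4)" and q: "q = 1 - x*(1-x/4)"
    by (simp_all add: p_def q_def field_simps power2_eq_square)
  have p1: "1 \<le> p" and q1: "0 \<le> q" "q \<le> 1" and gp: "1 + b \<le> p" and hp: "1 + a \<le> p"
  proof -
    have "p = 1 + x + x^2/4" "q = 1 - x + x^2/4" by (simp_all add: p q field_simps power2_eq_square)
    then show "1 \<le> p" "0 \<le> q" "q \<le> 1" "1 + b \<le> p" "1 + a \<le> p"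
      using x ab xx zero_le_power2[of x] by linarith+
  qed
  define D where "D j = p^(j+1) + q^(j+1) - cp * (1+a)^j - cm * (1+b)^j" for j
  define E where "E j = D (Suc (Suc j)) - 2 * D (Suc j) + D j" for j
  have E: "E j = p * (p-1)^2 * p^j + q * (1-q)^2 * q^j - cp * a^2 * (1+a)^j - cm * b^2 * (1+b)^j" for j
    unfolding E_def D_def by (simp add: algebra_simps power2_eq_square)
  \<comment> \<open>Since \<open>p\<close> is the largest of the four ratios, bounding every
    negative term of the third difference by a multiple of \<open>p^j\<close> leaves a single sign
    condition free of j. Hence only \<open>E 0\<close> has to be estimated.\<close>
  have Estep: "E (Suc j) \<ge> E j" for j
  proof -
    have pj: "1 \<le> p^j" using p1 by simp
    have "E (Suc j) - E j = p * (p-1)^3 * p^j - q * (1-q)^3 * q^j - cp * a^3 * (1+a)^j - cm * b^3 * (1+b)^j"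
      unfolding E by (simp add: algebra_simps power2_eq_square power3_eq_cube)
    moreover have "q * (1-q)^3 * q^j \<le> q * (1-q)^3 * p^j"
      using q1 p1 by (intro mult_left_mono) (auto intro: power_mono)
    moreover have "cp * a^3 * (1+a)^j \<le> cp * a^3 * p^j"
      using cp ab hp by (intro mult_left_mono) (auto intro: power_mono)
    moreover have "cm * b^3 * (1+b)^j \<le> cm * b^3 * p^j"
      using cm ab gp by (intro mult_left_mono) (auto intro: power_mono)
    ultimately have 1: "E (Suc j) - E j \<ge> (p * (p-1)^3 - q * (1-q)^3 - cp * a^3 - cm * b^3) * p^j"
      by (simp add: algebra_simps)
    have "p * x^3 \<le> p * (p-1)^3" using x p1 by (intro mult_left_mono power_mono) (auto simp: p)
    moreover have "q * (1-q)^3 \<le> q * x^3"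
      using x q1 by (intro mult_left_mono power_mono) (auto simp: q)
    moreover have "p * x^3 - q * x^3 = 2 * x^4" by (simp add: p q field_simps eval_nat_numeral)
    moreover have "cp * a^3 \<le> 3/2 * (x^2/4)^3" using cp ab by (intro mult_mono power_mono) auto
    moreover have "cm * b^3 \<le> 1 * (x^2/2)^3" using cm ab by (intro mult_mono power_mono) auto
    moreover have "3/2 * (x^2/4)^3 + 1 * (x^2/2)^3 = 19/128 * (x^2 * x^4)"
      by (simp add: field_simps eval_nat_numeral)
    moreover have "x^2 * x^4 \<le> 1/4 * x^4" using xx by (intro mult_right_mono) auto
    ultimately have "p * (p-1)^3 - q * (1-q)^3 - cp * a^3 - cm * b^3 \<ge> 0" using x34 by linarith
    then show ?thesis using 1 pj by (smt (verit) mult_nonneg_nonneg)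
  qed
  have E0: "E 0 \<ge> 2*x^2 + x^4"
  proof -
    have "p * (p-1)^2 + q * (1-q)^2 = 2*x^2 + 13/8*x^4 + x^6/32"
      by (simp add: p q field_simps eval_nat_numeral)
    moreover have "cp * a^2 \<le> 3/2 * (x^2/4)^2" using cp ab by (intro mult_mono power_mono) auto
    moreover have "cm * b^2 \<le> 1 * (x^2/2)^2" using cm ab by (intro mult_mono power_mono) auto
    moreover have "3/2 * (x^2/4)^2 + 1 * (x^2/2)^2 = 11/32 * x^4"
      by (simp add: field_simps eval_nat_numeral)
    moreover have "0 \<le> x^6" using x by simp
    moreover have "E 0 = p * (p-1)^2 + q * (1-q)^2 - cp * a^2 - cm * b^2" unfolding E by simp
    ultimately show ?thesis using x34 by linarith
  qed
  have Ege: "E j \<ge> 2*x^2" for j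
  proof (induction j)
    case 0
    then show ?case using E0 x34 by linarith
  next
    case (Suc j)
    then show ?case using Estep[of j] by linarith
  qed
  \<comment> \<open>The surplus \<open>x^4/4\<close> here pays for the deficit \<open>x^4/4\<close>
    allowed in the next step.\<close>
  have D0: "D 0 = x^2/4 + x^4/4"
    unfolding D_def cp_def cm_def p_def q_def by (simp add: algebra_simps power2_eq_square)
  have D1: "D 1 - D 0 \<ge> 2*x^2 - x^4/4"
  proof -
    have ax: "4*(1+x)*a = x^2" and bx: "4*(1-x)*b = x^2"
      using x by (auto simp: a_def b_def field_simps)
    have diff: "D 1 - D 0 = p*(p-1) - q*(1-q) - cp*a - cm*b"
      unfolding D_def by (simp add: algebra_simps)
    \<comment> \<open>The factor \<open>16*(1-x^2)\<close> clears the denominators of both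
      \<open>a\<close> and \<open>b\<close>.\<close>
    have "(D 1 - D 0 - (2*x^2 - x^4/4)) * (16*(1-x^2)) =
        16*(1-x^2)*(p*(p-1) - q*(1-q) - (2*x^2 - x^4/4))
        - 4*(1-x)*cp*(4*(1+x)*a) - 4*(1+x)*cm*(4*(1-x)*b)"
      unfolding diff by (simp add: algebra_simps power2_eq_square)
    also have "\<dots> = 16*(1-x^2)*(p*(p-1) - q*(1-q) - (2*x^2 - x^4/4))
        - 4*((1-x)*cp + (1+x)*cm)*x^2"
      unfolding ax bx by (simp add: algebra_simps)
    also have "(1-x)*cp + (1+x)*cm = 2 - 3/4*x^2 - 3/4*x^4"
      by (simp add: cp_def cm_def field_simps eval_nat_numeral)
    also have "p*(p-1) - q*(1-q) = 5/2*x^2 + x^4/8"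
      by (simp add: p q field_simps eval_nat_numeral)
    also have "16*(1-x^2)*(5/2*x^2 + x^4/8 - (2*x^2 - x^4/4)) - 4*(2 - 3/4*x^2 - 3/4*x^4)*x^2
        = x^4 * (1 - 3*x^2)"
      by (simp add: field_simps eval_nat_numeral)
    also have "\<dots> \<ge> 0" using xx by auto
    finally have "0 \<le> (D 1 - D 0 - (2*x^2 - x^4/4)) * (16*(1-x^2))" .
    moreover have "16*(1-x^2) > 0" using xx by auto
    ultimately have "0 \<le> D 1 - D 0 - (2*x^2 - x^4/4)" by (metis linorder_not_less mult_neg_pos)
    then show ?thesis by simp
  qed
  have "D j \<ge> (real j + 1/2)^2 * x^2"
  proof (rule second_difference_bound)
    show "D 0 \<ge> x^2/4" using D0 x34 by simp
    show "D 1 \<ge> 9/4*x^2" using D0 D1 by simp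
    show "D (Suc (Suc 0)) - D 1 \<ge> 4*x^2" using D1 E0 x34 unfolding E_def One_nat_def by linarith
  qed (use Ege in \<open>simp add: E_def\<close>)
  then show ?thesis unfolding D_def h g .
qed

section \<open>Sharing the edge energies between the vertices\<close>

text \<open>The edge between 0 and 1 goes entirely to its endpoint 1, because u(0) = 0.\<close>
definition edge_share :: "nat \<Rightarrow> real \<Rightarrow> real" where
  "edge_share j y = (if y = 0 then 0 else if y = 1 then (1/4)^(j+1)
     else ((y - 1/2)^2)^(j+1) - edge_factor y * (y * (y - 1/2)^2 / (y - 1))^j)"

text \<open>The inequality of arithmetic and geometric means for \<open>sqrt A * a\<close> and
  \<open>sqrt B * b\<close>.\<close>

lemma two_mult_le_weighted_squares:
  fixes A B w a b :: real
  assumes "A > 0" "B > 0" "w \<ge> 0" "w^2 \<le> A * B" "a \<ge> 0" "b \<ge> 0"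
  shows "2 * w * (a * b) \<le> A * a^2 + B * b^2"
proof -
  have "w \<le> sqrt (A * B)" using assms by (simp add: real_le_rsqrt)
  then have "2 * w * (a * b) \<le> 2 * sqrt (A * B) * (a * b)"
    using assms by (intro mult_right_mono) auto
  also have "\<dots> \<le> A * a^2 + B * b^2"
    using sum_squares_bound[of "sqrt A * a" "sqrt B * b"] assms
    by (simp add: power_mult_distrib real_sqrt_mult ac_simps)
  finally show ?thesis .
qed

text \<open>Here u and v stand for the values at n and n - 1. Reflection in 0 maps this edge to the
  one between -n and 1 - n, of equal weight, so the endpoint n - 1 receives the share at
  \<open>1 - n\<close>. The reverse triangle inequality reduces the claim to moduli, and the cross
  term is then split by a weighted mean inequality.\<close>

lemma edge_bound:
  fixes n :: int and u v :: complex
  assumes "n = 1 \<Longrightarrow> v = 0" "n = 0 \<Longrightarrow> u = 0"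
  shows "edge_share j (of_int n) * (cmod u)^2 + edge_share j (1 - of_int n) * (cmod v)^2
    \<le> (cmod (u - v))^2 * ((of_int n - 1/2)^2)^(j+1)"
proof -
  consider "n = 0" | "n = 1" | "n \<ge> 2 \<or> n \<le> -1" by linarith
  then show ?thesis
  proof cases
    case 1
    then show ?thesis using assms by (simp add: edge_share_def power2_eq_square norm_minus_commute)
  next
    case 2
    then show ?thesis using assms by (simp add: edge_share_def power2_eq_square)
  next
    case 3
    define y where "y = real_of_int n"
    have y: "y \<ge> 2 \<or> y \<le> -1" using 3 unfolding y_def by linarith
    define w where "w = ((y - 1/2)^2)^(j+1)"
    define A where "A = edge_factor y * (y * (y - 1/2)^2 / (y - 1))^j"
    define B where "B = edge_factor (1 - y) * ((1 - y) * (y - 1/2)^2 / (- y))^j"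
    have ne: "y \<noteq> 0" "y \<noteq> 1" using y by (elim disjE; simp)+
    have sq: "(1 - y - 1/2)^2 = (y - 1/2)^2" by (simp add: power2_eq_square algebra_simps)
    have pos: "y / (y - 1) > 0" "(1 - y) / (- y) > 0" "(y - 1/2)^2 > 0"
      using y by (auto simp: zero_less_divide_iff divide_less_0_iff)
    have ratio: "y * (y - 1/2)^2 / (y - 1) > 0" "(1 - y) * (y - 1/2)^2 / (- y) > 0"
      using mult_pos_pos[OF pos(1,3)] mult_pos_pos[OF pos(2,3)] by simp_all
    have "A > 0" "B > 0"
      unfolding A_def B_def using ratio y by (auto intro!: mult_pos_pos edge_factor_pos)
    moreover have "w^2 \<le> A * B"
    proof -
      \<comment> \<open>The quotients \<open>y / (y - 1)\<close> and \<open>(1 - y) / (- y)\<close>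
        are reciprocal; this is why the power j does not affect the edge condition.\<close>
      have "(y * (y - 1/2)^2 / (y - 1)) * ((1 - y) * (y - 1/2)^2 / (- y)) = (y - 1/2)^4"
        using ne by (simp add: divide_simps eval_nat_numeral) (simp add: algebra_simps)
      then have "A * B = (edge_factor y * edge_factor (1 - y)) * ((y - 1/2)^4)^j"
        unfolding A_def B_def by (metis mult.assoc mult.left_commute power_mult_distrib)
      also have "\<dots> \<ge> (y - 1/2)^4 * ((y - 1/2)^4)^j"
        using edge_factor_mult_ge[OF y] by (intro mult_right_mono) auto
      also have "(y - 1/2)^4 * ((y - 1/2)^4)^j = w^2"
      proof -
        have "4 * Suc j = 2 * (j + 1) * 2" by simp
        then show ?thesis unfolding w_def by (metis power_Suc power_mult)
      qed
      finally show ?thesis .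
    qed
    moreover have "w \<ge> 0" unfolding w_def by simp
    ultimately have "2 * w * (cmod u * cmod v) \<le> A * (cmod u)^2 + B * (cmod v)^2"
      by (intro two_mult_le_weighted_squares) auto
    moreover have "(cmod u - cmod v)^2 \<le> (cmod (u - v))^2"
      by (metis abs_le_square_iff norm_triangle_ineq3 abs_norm_cancel)
    then have "(cmod u - cmod v)^2 * w \<le> (cmod (u - v))^2 * w"
      using \<open>w \<ge> 0\<close> by (rule mult_right_mono)
    moreover have "edge_share j y = w - A" "edge_share j (1 - y) = w - B"
      using ne sq by (auto simp: edge_share_def w_def A_def B_def)
    moreover have "(cmod u - cmod v)^2 * w = w * (cmod u)^2 + w * (cmod v)^2 - 2 * w * (cmod u * cmod v)"
      by (simp add: algebra_simps power2_eq_square)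
    ultimately have "edge_share j y * (cmod u)^2 + edge_share j (1 - y) * (cmod v)^2 \<le> (cmod (u - v))^2 * w"
      by (simp add: left_diff_distrib)
    then show ?thesis unfolding y_def w_def .
  qed
qed

text \<open>This vertex corresponds to x = 1, outside the range of \<open>deficit_bound\<close>. The
  share from the edge between 1 and 2, which is \<open>edge_share j (-1)\<close>, suffices by
  itself.\<close>

lemma vertex_bound_one: "edge_share j 1 + edge_share j (-1) \<ge> (real j + 1/2)^2"
proof -
  define D where "D j = (9/4::real)^(j+1) - 7/4 * (9/8)^j" for j
  have "(real j + 1/2)^2 * 1 \<le> D j"
  proof (rule second_difference_bound)
    fix j
    have "(9/8::real)^j \<le> (9/4)^j" "1 \<le> (9/4::real)^j" by (auto intro: power_mono)
    moreover have "D (Suc (Suc j)) - 2 * D (Suc j) + D j = 225/64 * (9/4)^j - 7/256 * (9/8)^j"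
      unfolding D_def by simp
    ultimately show "2 * 1 \<le> D (Suc (Suc j)) - 2 * D (Suc j) + D j"
      by linarith
  qed (simp_all add: D_def power2_eq_square power3_eq_cube)
  moreover have "edge_share j (-1) = D j"
    unfolding edge_share_def edge_factor_def D_def by (simp add: power2_eq_square)
  moreover have "edge_share j 1 \<ge> 0" unfolding edge_share_def by simp
  ultimately show ?thesis by simp
qed

text \<open>The vertex y receives \<open>edge_share j y\<close> from the edge to y - 1 and
  \<open>edge_share j (-y)\<close> from the edge to y + 1. Factoring out
  \<open>y^(2*j) * y^2\<close> leaves \<open>deficit_bound\<close> at x = 1/y.\<close>

lemma vertex_bound:
  assumes y: "y = 1 \<or> y \<ge> 2"
  shows "edge_share j y + edge_share j (-y) \<ge> (real j + 1/2)^2 * y^(2*j)"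
proof (cases "y = 1")
  case True
  then show ?thesis using vertex_bound_one by simp
next
  case False
  then have y: "y \<ge> 2" using y by simp
  define x where "x = 1 / y"
  have x: "0 < x" "x \<le> 1/2" and yx: "y = 1 / x" using y by (auto simp: x_def field_simps)
  define p where "p = (1 + x/2)^2"
  define q where "q = (1 - x/2)^2"
  define cp where "cp = 1 + x/2 + x^2/8 + x^3/4 - x^4/8"
  define cm where "cm = 1 - x/2 + x^2/8 - x^3/4 - x^4/8"
  have q1: "(y - 1/2)^2 = y^2 * q" and p1: "(-y - 1/2)^2 = y^2 * p"
    and cm: "edge_factor y = y^2 * cm" and cp: "edge_factor (-y) = y^2 * cp"
    using x unfolding q_def p_def cm_def cp_def edge_factor_def yx
    by (simp_all add: field_simps eval_nat_numeral)
  have q2: "y * (y^2 * q) / (y - 1) = y^2 * (q / (1 - x))"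
    and p2: "- y * (y^2 * p) / (- y - 1) = y^2 * (p / (1 + x))"
    using y unfolding x_def by (simp_all add: field_simps)
  have yj: "y^(2*j) = (y^2)^j" by (rule power_mult)
  have "edge_share j y = y^(2*j) * y^2 * (q^(j+1) - cm * (q / (1 - x))^j)"
    using y unfolding edge_share_def q1 cm q2 yj power_mult_distrib power_add
    by (simp add: right_diff_distrib mult_ac)
  moreover have "edge_share j (-y) = y^(2*j) * y^2 * (p^(j+1) - cp * (p / (1 + x))^j)"
    using y unfolding edge_share_def p1 cp p2 yj power_mult_distrib power_add
    by (simp add: right_diff_distrib mult_ac)
  ultimately have "edge_share j y + edge_share j (-y) = y^(2*j) * y^2 *
      (p^(j+1) + q^(j+1) - cp * (p/(1+x))^j - cm * (q/(1-x))^j)"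
    by (simp add: algebra_simps)
  also have "\<dots> \<ge> y^(2*j) * y^2 * ((real j + 1/2)^2 * x^2)"
    using deficit_bound[OF x, of j]
      unfolding p_def q_def cp_def cm_def by (intro mult_left_mono) auto
  also have "y^(2*j) * y^2 * ((real j + 1/2)^2 * x^2) = (real j + 1/2)^2 * y^(2*j)"
    using y unfolding x_def by (simp add: field_simps)
  finally show ?thesis .
qed

section \<open>Summation over all edges\<close>

lemma infsum_eq_sum_superset:
  fixes f :: "'a \<Rightarrow> real"
  assumes "finite F" "\<And>x. x \<notin> F \<Longrightarrow> f x = 0"
  shows "infsum f UNIV = sum f F"
proof -
  have "infsum f UNIV = infsum f F" using assms by (intro infsum_cong_neutral) auto
  then show ?thesis using assms by simp
qed

lemma discrete_hardy:
  fixes u :: "int \<Rightarrow> complex"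
  assumes fin: "finite {n. u n \<noteq> 0}" and u0: "u 0 = 0"
  shows "(real j + 1/2)^2 * (\<Sum>\<^sub>\<infinity>n\<in>UNIV. (cmod (u n))^2 * real_of_int n ^ (2*j))
     \<le> (\<Sum>\<^sub>\<infinity>n\<in>UNIV. (cmod (u n - u (n - 1)))^2 * ((real_of_int n - 1/2)^2) ^ (j+1))"
proof -
  define S where "S = {n. u n \<noteq> 0}"
  \<comment> \<open>Edges are indexed by their right endpoint, so the edges that meet the support
    are those in \<open>S\<close> or in its shift \<open>S'\<close>.\<close>
  define S' where "S' = (\<lambda>n. n + 1) ` S"
  have [simp]: "finite S" "finite S'" using fin by (simp_all add: S_def S'_def)
  have out: "u n = 0" if "n \<notin> S" for n using that by (simp add: S_def)
  have out': "u (n - 1) = 0" if "n \<notin> S'" for n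
    using that out[of "n - 1"] by (force simp: S'_def image_iff)
  have vertex: "(real j + 1/2)^2 * real_of_int n ^ (2*j) \<le> edge_share j (of_int n) + edge_share j (- of_int n)"
    if "n \<in> S" for n
  proof -
    have "n \<noteq> 0" using that u0 by (auto simp: S_def)
    \<comment> \<open>The sum of the two shares at a vertex is symmetric in the sign of n, so
      negative vertices reduce to positive ones.\<close>
    then have "n = 1 \<or> n \<ge> 2 \<or> - n = 1 \<or> - n \<ge> 2" by linarith
    then consider "real_of_int n = 1 \<or> real_of_int n \<ge> 2"
      | "real_of_int (-n) = 1 \<or> real_of_int (-n) \<ge> 2"
      by (metis of_int_1 of_int_le_iff of_int_numeral)
    then show ?thesis
      by cases (use vertex_bound[of "of_int n" j] vertex_bound[of "of_int (-n)" j] in auto)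
  qed
  have "(real j + 1/2)^2 * (\<Sum>\<^sub>\<infinity>n\<in>UNIV. (cmod (u n))^2 * real_of_int n ^ (2*j))
      = (\<Sum>n\<in>S. ((real j + 1/2)^2 * real_of_int n ^ (2*j)) * (cmod (u n))^2)"
    by (subst infsum_eq_sum_superset[of S]) (auto simp: out sum_distrib_left ac_simps)
  also have "\<dots> \<le> (\<Sum>n\<in>S. (edge_share j (of_int n) + edge_share j (- of_int n)) * (cmod (u n))^2)"
    using vertex by (intro sum_mono mult_right_mono) auto
  also have "\<dots> = (\<Sum>n\<in>S. edge_share j (of_int n) * (cmod (u n))^2)
      + (\<Sum>n\<in>S. edge_share j (- of_int n) * (cmod (u n))^2)"
    by (simp add: distrib_right sum.distrib)
  also have "(\<Sum>n\<in>S. edge_share j (- of_int n) * (cmod (u n))^2)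
      = (\<Sum>n\<in>S'. edge_share j (1 - of_int n) * (cmod (u (n - 1)))^2)"
    unfolding S'_def by (subst sum.reindex) (auto simp: inj_on_def)
  also have "\<dots> = (\<Sum>n\<in>S \<union> S'. edge_share j (1 - of_int n) * (cmod (u (n - 1)))^2)"
    by (intro sum.mono_neutral_left) (auto simp: out')
  also have "(\<Sum>n\<in>S. edge_share j (of_int n) * (cmod (u n))^2)
      = (\<Sum>n\<in>S \<union> S'. edge_share j (of_int n) * (cmod (u n))^2)"
    by (intro sum.mono_neutral_left) (auto simp: out)
  also have "\<dots> + (\<Sum>n\<in>S \<union> S'. edge_share j (1 - of_int n) * (cmod (u (n - 1)))^2)
      \<le> (\<Sum>n\<in>S \<union> S'. (cmod (u n - u (n - 1)))^2 * ((real_of_int n - 1/2)^2) ^ (j+1))"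
    unfolding sum.distrib[symmetric] using u0 by (intro sum_mono edge_bound) auto
  also have "\<dots> = (\<Sum>\<^sub>\<infinity>n\<in>UNIV. (cmod (u n - u (n - 1)))^2 * ((real_of_int n - 1/2)^2) ^ (j+1))"
    by (rule infsum_eq_sum_superset[symmetric]) (auto simp: out out')
  finally show ?thesis .
qed

section \<open>Sharpness by cutting off the critical power\<close>

lemma infsum_int_eq_sum_nat:
  fixes f :: "int \<Rightarrow> real"
  assumes "\<And>n. n \<le> 0 \<or> n > int L \<Longrightarrow> f n = 0"
  shows "infsum f UNIV = (\<Sum>i\<in>{1..L}. f (int i))"
proof -
  have "infsum f UNIV = sum f {1..int L}"
    using assms by (intro infsum_eq_sum_superset) (auto simp: not_le)
  also have "{1..int L} = int ` {1..L}"
    using image_int_atLeastAtMost[of 1 L] by simp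
  also have "sum f (int ` {1..L}) = (\<Sum>i\<in>{1..L}. f (int i))"
    by (subst sum.reindex) auto
  finally show ?thesis .
qed

text \<open>By the mean value theorem, since the derivative is largest in modulus at the left
  end.\<close>

lemma powr_diff_le:
  fixes s :: real
  assumes "s > 0" "m > 0"
  shows "m powr (-s) - (m + 1) powr (-s) \<le> s * m powr (-s - 1)"
proof -
  have "\<exists>z. m < z \<and> z < m + 1 \<and> (m + 1) powr (-s) - m powr (-s) = (m + 1 - m) * (-s * z powr (-s - 1))"
  proof (rule MVT2)
    fix x assume "m \<le> x" "x \<le> m + 1"
    then show "((\<lambda>x. x powr (-s)) has_real_derivative -s * x powr (-s - 1)) (at x)"
      using assms by (intro has_real_derivative_powr) auto
  qed simp
  then obtain z where z: "m < z" "(m + 1) powr (-s) - m powr (-s) = -s * z powr (-s - 1)" by auto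
  have "z powr (-s - 1) \<le> m powr (-s - 1)"
    using assms z(1) by (intro powr_mono2') auto
  then have "s * z powr (-s - 1) \<le> s * m powr (-s - 1)" using assms by simp
  then show ?thesis using z(2) by linarith
qed

text \<open>The exponent is critical: the profile turns the weighted square sum into the harmonic
  series.\<close>

lemma powr_minus_half_square:
  assumes "x > (0::real)"
  shows "(x powr (- (real j + 1/2)))^2 * x^(2*j) = inverse x"
proof -
  have "(x powr (- (real j + 1/2)))^2 * x^(2*j)
      = x powr (- (real j + 1/2)) * x powr (- (real j + 1/2)) * x powr (real (2*j))"
    using assms powr_realpow[of x "2*j"] by (simp add: power2_eq_square)
  also have "\<dots> = x powr (-1)" unfolding powr_add[symmetric] by simp
  finally show ?thesis using assms by (simp add: powr_minus)
qed

text \<open>The energy of the edge between m and m + 1 is compared with \<open>s^2\<close> times the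
  harmonic term at m + 1; the extra factors tend to 1.\<close>

lemma power_profile_energy:
  fixes j :: nat
  defines "s \<equiv> real j + 1/2"
  assumes m: "m > (0::real)"
  shows "((m + 1) powr (-s) - m powr (-s))^2 * (m + 1/2)^(2*(j+1))
    \<le> s^2 * (1 + (1/2)/m)^(2*(j+1)) * (1 + 1/m) * inverse (m + 1)"
proof -
  have s: "s > 0" by (simp add: s_def)
  have "(m + 1) powr (-s) \<le> m powr (-s)" using m s by (intro powr_mono2') auto
  then have "((m + 1) powr (-s) - m powr (-s))^2 \<le> (s * m powr (-s - 1))^2"
    using powr_diff_le[OF s m] by (subst power2_commute, intro power_mono) auto
  then have "((m + 1) powr (-s) - m powr (-s))^2 * (m + 1/2)^(2*(j+1))
      \<le> (s * m powr (-s - 1))^2 * (m + 1/2)^(2*(j+1))"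
    using m by (intro mult_right_mono) auto
  also have "\<dots> = (s * (m powr (-s) / m))^2 * (m * (1 + (1/2)/m))^(2*(j+1))"
  proof -
    have "m * (1 + (1/2)/m) = m + 1/2" using m by (simp add: field_simps)
    then show ?thesis using m by (simp add: powr_diff del: power_Suc)
  qed
  also have "\<dots>
      = s^2 * (1 + (1/2)/m)^(2*(j+1)) * ((m powr (-s))^2 * m^(2*j))"
  proof -
    define e where "e = 2 * (j + 1)"
    have "m^e = m^2 * m^(2*j)" unfolding e_def by (simp flip: power_add)
    then show ?thesis using m
      unfolding e_def[symmetric] by (simp add: power_mult_distrib power_divide)
  qed
  also have "(m powr (-s))^2 * m^(2*j) = (1 + 1/m) * inverse (m + 1)"
    unfolding s_def powr_minus_half_square[OF m] using m by (simp add: field_simps)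
  finally show ?thesis by (simp add: mult.assoc)
qed

lemma discrete_hardy_sharp:
  fixes C :: real
  assumes C: "C > (real j + 1/2)^2"
  obtains u :: "int \<Rightarrow> complex" where "finite {n. u n \<noteq> 0}" "u 0 = 0"
    "(\<Sum>\<^sub>\<infinity>n\<in>UNIV. (cmod (u n - u (n - 1)))^2 * (real_of_int n - 1/2) ^ (2*(j+1)))
      < C * (\<Sum>\<^sub>\<infinity>n\<in>UNIV. (cmod (u n))^2 * real_of_int n ^ (2*j))"
proof -
  define s where "s = real j + 1/2"
  define k where "k = j + 1"
  \<comment> \<open>The energy of the profile before the cut-off, on the edge between i - 1 and
    i.\<close>
  define T where "T i = (real i powr (-s) - real (i - 1) powr (-s))^2 * (real i - 1/2)^(2*k)" for i
  have T0: "T i \<ge> 0" if "i \<ge> 1" for i using that unfolding T_def by simp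
  \<comment> \<open>A constant strictly between \<open>s^2\<close> and C: the gap to
    \<open>s^2\<close> absorbs the factors tending to 1, the gap to C absorbs the bounded
    terms.\<close>
  define C' where "C' = (s^2 + C) / 2"
  have C': "s^2 < C'" "C' < C" "0 < C'" using C by (auto simp: C'_def s_def)
      (smt (verit) zero_le_power2)
  have C0: "C > 0" using C' by linarith

  have "(\<lambda>m. s^2 * (1 + (1/2)/real m)^(2*k) * (1 + 1/real m)) \<longlonglongrightarrow> s^2 * (1 + 0)^(2*k) * (1 + 0)"
    by (intro tendsto_intros lim_const_over_n)
  then have "\<forall>\<^sub>F m in sequentially. s^2 * (1 + (1/2)/real m)^(2*k) * (1 + 1/real m) < C'"
    using C' by (intro order_tendstoD(2)) auto
  then obtain M0 where M0: "\<And>m. m \<ge> M0 \<Longrightarrow> s^2 * (1 + (1/2)/real m)^(2*k) * (1 + 1/real m) < C'"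
    by (auto simp: eventually_sequentially)
  \<comment> \<open>The shift by one keeps m = i - 1 positive for i > M.\<close>
  define M where "M = Suc M0"
  have TM: "T i \<le> C' * inverse (real i)" if iM: "i > M" for i
  proof -
    obtain m where i: "i = Suc m" "m \<ge> M0" "m > 0" using iM unfolding M_def by (cases i) auto
    have "T i \<le> s^2 * (1 + (1/2)/real m)^(2*k) * (1 + 1/real m) * inverse (real m + 1)"
      using power_profile_energy[of "real m" j] i
        unfolding T_def s_def k_def by (simp add: add.commute)
    also have "\<dots> \<le> C' * inverse (real m + 1)"
      using M0[OF i(2)] by (intro mult_right_mono) auto
    finally show ?thesis using i by (simp add: add.commute)
  qed
  define K where "K = (\<Sum>i\<in>{1..M}. T i)"
  have Tsum: "(\<Sum>i\<in>{1..N}. T i) \<le> K + C' * harm N" for N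
  proof -
    have "(\<Sum>i\<in>{1..N}. T i) \<le> (\<Sum>i\<in>{1..N}. (if i \<le> M then T i else 0) + C' * inverse (real i))"
      using TM C' by (intro sum_mono) auto
    also have "\<dots> = (\<Sum>i\<in>{1..N}. if i \<le> M then T i else 0) + C' * harm N"
      by (simp add: sum.distrib harm_def sum_distrib_left)
    also have "(\<Sum>i\<in>{1..N}. if i \<le> M then T i else 0) = (\<Sum>i\<in>{i\<in>{1..N}. i \<le> M}. T i)"
      by (rule sum.inter_filter[symmetric]) simp
    also have "\<dots> \<le> K" unfolding K_def using T0 by (intro sum_mono2) auto
    finally show ?thesis by simp
  qed

  \<comment> \<open>The constant \<open>K\<close> accounts for the initial edges and
    \<open>4^k\<close> for all edges of the cut-off; neither depends on N.\<close>
  have "\<forall>\<^sub>F N in sequentially. harm N > (K + 4^k) / (C - C')"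
    using harm_at_top unfolding filterlim_at_top_dense by blast
  then obtain N where N: "harm N > (K + 4^k) / (C - C')" "N \<ge> 1"
    using eventually_conj[OF _ eventually_ge_at_top[of 1]] eventually_happens' sequentially_bot
      by (metis (mono_tags, lifting))
  have hN: "K + C' * harm N + 4^k < C * harm N"
    using N(1) C' by (simp add: field_simps)

  \<comment> \<open>At 0 the first branch is \<open>0 powr (-s) = 0\<close>, as
    \<open>u 0 = 0\<close> requires. The linear piece continues the first branch at N and reaches 0
    at 2N.\<close>
  define v where "v i = (if i \<le> N then real i powr (-s)
     else if i \<le> 2*N then real N powr (-s) * (2 - real i / real N) else 0)" for i :: nat
  define u where "u n = complex_of_real (v (nat n))" for n :: int
  have v0: "v 0 = 0" by (simp add: v_def)
  have v2: "v i = 0" if "i \<ge> 2*N" for i using that N(2) by (auto simp: v_def)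
  \<comment> \<open>Vanishing at 2N itself makes every edge difference with n > 2N vanish.\<close>
  have u_out: "u n = 0" if "n \<le> 0 \<or> n \<ge> 2*int N" for n
    using that v0 v2[of "nat n"] by (auto simp: u_def)

  have D: "(\<Sum>\<^sub>\<infinity>n\<in>UNIV. (cmod (u n))^2 * real_of_int n ^ (2*j)) \<ge> harm N"
  proof -
    have "harm N = (\<Sum>i\<in>{1..N}. (v i)^2 * real i^(2*j))"
      unfolding harm_def v_def s_def using powr_minus_half_square by (intro sum.cong) auto
    also have "\<dots> \<le> (\<Sum>i\<in>{1..2*N}. (v i)^2 * real i^(2*j))"
      by (intro sum_mono2) auto
    also have "\<dots> = (\<Sum>\<^sub>\<infinity>n\<in>UNIV. (cmod (u n))^2 * real_of_int n ^ (2*j))"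
      using u_out by (subst infsum_int_eq_sum_nat[of "2*N"]) (auto simp: u_def)
    finally show ?thesis .
  qed

  \<comment> \<open>The slope is \<open>N powr (-s) / N\<close> and the weight at most
    \<open>(2*N)^(2*k)\<close>, so each of the N cut-off edges costs at most
    \<open>4^k / N\<close>.\<close>
  have tail: "(v i - v (i - 1))^2 * (real i - 1/2)^(2*k) \<le> 4^k / real N" if i: "i \<in> {N+1..2*N}" for i
  proof -
    \<comment> \<open>For i = N + 1 the index i - 1 = N lies in the first branch, where the linear
      formula gives the same value.\<close>
    have "v (i - 1) = real N powr (-s) * (2 - real (i - 1) / real N)"
    proof (cases "i = N + 1")
      case True
      then show ?thesis using N(2) by (simp add: v_def)
    qed (use i in \<open>auto simp: v_def\<close>)
    then have "v i - v (i - 1) = - (real N powr (-s) / real N)"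
      using i N(2) by (simp add: v_def field_simps of_nat_diff)
    then have "(v i - v (i - 1))^2 = (real N powr (-s) / real N)^2" by (metis power2_minus)
    moreover have "(real i - 1/2)^(2*k) \<le> (2 * real N)^(2*k)"
      using i by (intro power_mono) auto
    ultimately have "(v i - v (i - 1))^2 * (real i - 1/2)^(2*k)
        \<le> (real N powr (-s) / real N)^2 * (2 * real N)^(2*k)"
      by (simp only: mult_left_mono zero_le_power2)
    also have "\<dots> = 4^k * ((real N powr (-s))^2 * real N^(2*j))"
    proof -
      have 4: "(2::real)^(2*k) = 4^k" by (simp add: power_mult)
      have Nk: "real N^(2*k) = real N^2 * real N^(2*j)" unfolding k_def by (simp flip: power_add)
      have "real N \<noteq> 0" using N(2) by simp
      then show ?thesis unfolding power_mult_distrib power_divide 4 Nk by simp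
    qed
    also have "\<dots> = 4^k / real N"
      unfolding s_def using N(2) by (subst powr_minus_half_square) (auto simp: divide_inverse)
    finally show ?thesis .
  qed

  have "(\<Sum>\<^sub>\<infinity>n\<in>UNIV. (cmod (u n - u (n - 1)))^2 * (real_of_int n - 1/2)^(2*k))
      = (\<Sum>i\<in>{1..2*N}. (cmod (u (int i) - u (int i - 1)))^2 * (real i - 1/2)^(2*k))"
    using u_out by (subst infsum_int_eq_sum_nat[of "2*N"]) auto
  also have "\<dots> = (\<Sum>i\<in>{1..2*N}. (v i - v (i - 1))^2 * (real i - 1/2)^(2*k))"
  proof (intro sum.cong refl)
    fix i assume i: "i \<in> {1..2*N}"
    then have "nat (int i - 1) = i - 1" by auto
    then have "u (int i) - u (int i - 1) = complex_of_real (v i - v (i - 1))"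
      by (simp add: u_def)
    then have "(cmod (u (int i) - u (int i - 1)))^2 = (v i - v (i - 1))^2"
      by (simp only: norm_of_real power2_abs)
    then show "(cmod (u (int i) - u (int i - 1)))^2 * (real i - 1/2)^(2*k)
      = (v i - v (i - 1))^2 * (real i - 1/2)^(2*k)" by simp
  qed
  also have "\<dots> = (\<Sum>i\<in>{1..N}. (v i - v (i - 1))^2 * (real i - 1/2)^(2*k))
      + (\<Sum>i\<in>{N+1..2*N}. (v i - v (i - 1))^2 * (real i - 1/2)^(2*k))"
    using sum.ub_add_nat[of 1 N "\<lambda>i. (v i - v (i - 1))^2 * (real i - 1/2)^(2*k)" N]
    by (simp add: mult_2)
  also have "(\<Sum>i\<in>{1..N}. (v i - v (i - 1))^2 * (real i - 1/2)^(2*k)) = (\<Sum>i\<in>{1..N}. T i)"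
    by (intro sum.cong) (auto simp: v_def T_def)
  also have "\<dots> + (\<Sum>i\<in>{N+1..2*N}. (v i - v (i - 1))^2 * (real i - 1/2)^(2*k))
      \<le> (K + C' * harm N) + (\<Sum>i\<in>{N+1..2*N}. 4^k / real N)"
    using tail by (intro add_mono Tsum sum_mono)
  also have "\<dots> = K + C' * harm N + 4^k" using N(2) by simp
  also have "\<dots> < C * harm N" by (rule hN)
  also have "\<dots> \<le> C * (\<Sum>\<^sub>\<infinity>n\<in>UNIV. (cmod (u n))^2 * real_of_int n ^ (2*j))"
    using D C0 by simp
  finally have fin: "(\<Sum>\<^sub>\<infinity>n\<in>UNIV. (cmod (u n - u (n - 1)))^2 * (real_of_int n - 1/2)^(2*k))
      < C * (\<Sum>\<^sub>\<infinity>n\<in>UNIV. (cmod (u n))^2 * real_of_int n ^ (2*j))" .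
  have "n \<in> {0..2*int N}" if "u n \<noteq> 0" for n using that u_out[of n] by force
  then have "{n. u n \<noteq> 0} \<subseteq> {0..2*int N}" by blast
  then have "finite {n. u n \<noteq> 0}" by (rule finite_subset) simp
  then show thesis using that[of u] fin u_out[of 0] by (simp add: k_def)
qed

section \<open>Passage from j to the exponent k = j + 1\<close>

theorem corollary2p3:
  fixes k :: nat
  assumes "k \<ge> 1"
  shows "(\<forall>u :: int \<Rightarrow> complex. finite {n. u n \<noteq> 0} \<and> u 0 = 0 \<longrightarrow>
            (\<Sum>\<^sub>\<infinity>n\<in>UNIV. (cmod (u n - u (n - 1)))\<^sup>2 * (real_of_int n - 1 / 2) ^ (2 * k))
              \<ge> (2 * real k - 1)\<^sup>2 / 4 *
                 (\<Sum>\<^sub>\<infinity>n\<in>UNIV. (cmod (u n))\<^sup>2 * real_of_int n ^ (2 * k - 2)))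
       \<and> (\<forall>C :: real. C > (2 * real k - 1)\<^sup>2 / 4 \<longrightarrow>
            (\<exists>u :: int \<Rightarrow> complex. finite {n. u n \<noteq> 0} \<and> u 0 = 0 \<and>
              \<not> (\<Sum>\<^sub>\<infinity>n\<in>UNIV. (cmod (u n - u (n - 1)))\<^sup>2 * (real_of_int n - 1 / 2) ^ (2 * k))
                \<ge> C * (\<Sum>\<^sub>\<infinity>n\<in>UNIV. (cmod (u n))\<^sup>2 * real_of_int n ^ (2 * k - 2))))"
proof -
  obtain j where k: "k = j + 1" using assms by (metis add.commute le_Suc_ex)
  have [simp]: "2 * (j + 1) - 2 = 2 * j" by simp
  have const: "(2 * real k - 1)^2 / 4 = (real j + 1/2)^2"
    unfolding k by (simp add: power2_eq_square field_simps)
  have weight: "((real_of_int n - 1/2)^2)^(j+1) = (real_of_int n - 1/2)^(2*(j+1))" for n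
    by (rule power_mult[symmetric])
  show ?thesis
    unfolding const unfolding k
  proof (intro conjI allI impI)
    fix u :: "int \<Rightarrow> complex"
    assume "finite {n. u n \<noteq> 0} \<and> u 0 = 0"
    then show "(real j + 1/2)^2 * (\<Sum>\<^sub>\<infinity>n\<in>UNIV. (cmod (u n))^2 * real_of_int n ^ (2*(j+1) - 2))
        \<le> (\<Sum>\<^sub>\<infinity>n\<in>UNIV. (cmod (u n - u (n - 1)))^2 * (real_of_int n - 1/2)^(2*(j+1)))"
      using discrete_hardy[of u j] unfolding weight by simp
  next
    fix C :: real
    assume "C > (real j + 1/2)^2"
    then obtain u :: "int \<Rightarrow> complex" where "finite {n. u n \<noteq> 0}" "u 0 = 0"
      "(\<Sum>\<^sub>\<infinity>n\<in>UNIV. (cmod (u n - u (n - 1)))^2 * (real_of_int n - 1/2)^(2*(j+1)))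
        < C * (\<Sum>\<^sub>\<infinity>n\<in>UNIV. (cmod (u n))^2 * real_of_int n ^ (2*j))"
      by (rule discrete_hardy_sharp)
    then show "\<exists>u :: int \<Rightarrow> complex. finite {n. u n \<noteq> 0} \<and> u 0 = 0 \<and>
        \<not> C * (\<Sum>\<^sub>\<infinity>n\<in>UNIV. (cmod (u n))^2 * real_of_int n ^ (2*(j+1) - 2))
          \<le> (\<Sum>\<^sub>\<infinity>n\<in>UNIV. (cmod (u n - u (n - 1)))^2 * (real_of_int n - 1/2)^(2*(j+1)))"
      by (intro exI[of _ u]) (simp add: not_le)
  qed
qed

end
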